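(* For all $n,j,\gamma\in\mathbb{N}_0$, the Jacobi-Stirling number $\genfrac{\{}{\}}{0pt}{}{n}{j}_{\gamma}$ is the number of Jacobi-Stirling set partitions of $[n]_2$ into $\gamma$ zero blocks and $j$ nonzero blocks.
   Context: $\mathbb{N}=\{1,2,3,\dots\}$ and $\mathbb{N}_0=\{0,1,2,\dots\}$. **Jacobi-Stirling numbers (of the second kind).** For $n,j\in\mathbb{N}_0$, $\genfrac{\{}{\}}{0pt}{}{n}{j}_{\gamma}$ is the polynomial in $\gamma$ determined by the initial conditions $\genfrac{\{}{\}}{0pt}{}{n}{0}_{\gamma}=\delta_{n,0}$, $\genfrac{\{}{\}}{0pt}{}{0}{j}_{\gamma}=\delta_{j,0}$ for $n,j\in\mathbb{N}_0$, and the recurrence $$\genfrac{\{}{\}}{0pt}{}{n}{j}_{\gamma}=\genfrac{\{}{\}}{0pt}{}{n-1}{j-1}_{\gamma}+j(j+2\gamma-1)\genfrac{\{}{\}}{0pt}{}{n-1}{j}_{\gamma}\qquad(n,j\in\mathbb{N}).$$ Equivalently, it is the coefficient of $x^{n-j}$ in the power series expansion of $\prod_{m=1}^{j}\frac{1}{1-m(m+2\gamma-1)x}$. **The set $[n]_2$.** $[n]_2=\{1_1,1_2,2_1,2_2,\ldots,n_1,n_2\}$ contains two (differently coloured) copies $i_1,i_2$ of each integer $i$ with $1\le i\le n$; $[0]_2=\varnothing$. **Jacobi-Stirling set partitions.** For $n,j,\gamma\in\mathbb{N}_0$, a Jacobi-Stirling set partition of $[n]_2$ into $\gamma$ zero blocks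 and $j$ nonzero blocks is a partition of $[n]_2$ into $j+\gamma$ pairwise disjoint blocks (with union $[n]_2$) such that: 1. $\gamma$ of the blocks, called the zero blocks, are distinguishable (i.e. labelled), while all the other blocks (the nonzero blocks) are indistinguishable; 2. the zero blocks may be empty, but all other blocks are nonempty; 3. the union of the zero blocks does not contain both copies of any number; 4. each nonzero block contains both copies of the smallest number it contains, but does not contain both copies of any other number. *)

theory Defs
  imports
    "HOL-Computational_Algebra.Polynomial"
    "HOL-Library.Disjoint_Sets"
begin

text \<open>The indeterminate \<^term>\<open>[:0, 1:]\<close> plays the role of the parameter \<open>\<gamma>\<close>.\<close>

fun jacobi_stirling :: "nat \<Rightarrow> nat \<Rightarrow> int poly" where
  "jacobi_stirling 0 0 = 1"
| "jacobi_stirling (Suc n) 0 = 0"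
| "jacobi_stirling 0 (Suc j) = 0"
| "jacobi_stirling (Suc n) (Suc j) =
     jacobi_stirling n j
     + of_nat (Suc j) * (of_nat (Suc j) + 2 * [:0, 1:] - 1) * jacobi_stirling n (Suc j)"

text \<open>The copy \<open>i\<^sub>c\<close> of the number \<open>i\<close> with colour \<open>c\<close> is the pair \<open>(i, c)\<close>.\<close>

definition two_copies :: "nat \<Rightarrow> (nat \<times> nat) set" where
  "two_copies n = {1..n} \<times> {1, 2}"

definition both_copies_in :: "nat \<Rightarrow> (nat \<times> nat) set \<Rightarrow> bool" where
  "both_copies_in i B \<longleftrightarrow> (i, 1) \<in> B \<and> (i, 2) \<in> B"

text \<open>
  A partition is a pair \<open>(Z, N)\<close>: the list \<open>Z\<close> of the labelled zero blocks (the label being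
  the position in the list, so that several of them may be empty) and the set \<open>N\<close> of the
  unlabelled nonzero blocks.
\<close>

definition JS_set_partitions ::
    "nat \<Rightarrow> nat \<Rightarrow> nat \<Rightarrow> ((nat \<times> nat) set list \<times> (nat \<times> nat) set set) set" where
  "JS_set_partitions n j \<gamma> = {(Z, N).
     length Z = \<gamma> \<and> card N = j \<and>
     disjoint_family_on (\<lambda>i. Z ! i) {..<\<gamma>} \<and> disjoint N \<and>
     (\<forall>A\<in>set Z. \<forall>B\<in>N. A \<inter> B = {}) \<and>
     \<Union>(set Z) \<union> \<Union>N = two_copies n \<and>
     {} \<notin> N \<and>
     (\<forall>i. \<not> both_copies_in i (\<Union>(set Z))) \<and>
     (\<forall>B\<in>N. both_copies_in (Min (fst ` B)) B \<and>
        (\<forall>i. i \<noteq> Min (fst ` B) \<longrightarrow> \<not> both_copies_in i B))}"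

text \<open>Finiteness, so that \<^const>\<open>card\<close> really counts these partitions.\<close>

lemma finite_JS_set_partitions: "finite (JS_set_partitions n j \<gamma>)"
proof (rule finite_subset)
  show "JS_set_partitions n j \<gamma> \<subseteq>
      {Z. set Z \<subseteq> Pow (two_copies n) \<and> length Z = \<gamma>} \<times> Pow (Pow (two_copies n))"
    unfolding JS_set_partitions_def by fast
  show "finite ({Z. set Z \<subseteq> Pow (two_copies n) \<and> length Z = \<gamma>} \<times> Pow (Pow (two_copies n)))"
    by (intro finite_cartesian_product finite_lists_length_eq) (simp_all add: two_copies_def)
qed

end

theory Submission
  imports Defs
begin

text \<open>
  The number of partitions satisfies the same recurrence as the Jacobi-Stirling numbers. To see
  this, look at the two copies of the largest number \<open>n + 1\<close> in a partition of \<open>[n + 1]\<^sub>2\<close> into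
  \<open>\<gamma>\<close> zero blocks and \<open>j\<close> nonzero blocks.

  If they lie in a common block, this block is nonzero and \<open>n + 1\<close> is its minimum, so it consists
  of these two copies only. Deleting it leaves an arbitrary partition of \<open>[n]\<^sub>2\<close> into \<open>\<gamma>\<close> zero
  blocks and \<open>j - 1\<close> nonzero blocks (lemma \<open>card_with_top_block\<close>).

  Otherwise they lie in two different blocks, at least one of which is nonzero, and no block
  disappears when they are deleted, since a nonzero block contains both copies of its minimum.
  Conversely, in a partition of \<open>[n]\<^sub>2\<close> with \<open>j\<close> nonzero blocks the two copies may be placed into
  any two different blocks that are not both zero (lemma \<open>bij_betw_extend\<close>). The first
  copy may go to one of the \<open>j\<close> nonzero blocks and the second to one of the \<open>j + \<gamma> - 1\<close> others, or
  the first to one of the \<open>\<gamma>\<close> zero blocks and the second to one of the \<open>j\<close> nonzero ones. These are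
  \<open>j (j + \<gamma> - 1) + \<gamma> j = j (j + 2 \<gamma> - 1)\<close> possibilities (lemma \<open>card_placements\<close>).
\<close>

section \<open>Addressing all blocks uniformly\<close>

text \<open>
  The address \<open>Inl i\<close> stands for the zero block with label \<open>i\<close>, which may coincide as a set with
  other zero blocks when it is empty; a nonzero block is its own address.
\<close>

definition addresses :: "nat \<Rightarrow> (nat \<times> nat) set set \<Rightarrow> (nat + (nat \<times> nat) set) set" where
  "addresses \<gamma> N = Inl ` {..<\<gamma>} \<union> Inr ` N"

fun block_at :: "(nat \<times> nat) set list \<Rightarrow> nat + (nat \<times> nat) set \<Rightarrow> (nat \<times> nat) set" where
  "block_at Z (Inl i) = Z ! i"
| "block_at Z (Inr B) = B"

text \<open>
  The witness \<open>m\<close> replaces the explicit minimum; in this form the condition is easy to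
  transport when elements above \<open>m\<close> are added or removed.
\<close>

definition nonzero_block :: "(nat \<times> nat) set \<Rightarrow> bool" where
  "nonzero_block B \<longleftrightarrow>
     (\<exists>m. both_copies_in m B \<and> (\<forall>p\<in>B. m \<le> fst p) \<and> (\<forall>i. i \<noteq> m \<longrightarrow> \<not> both_copies_in i B))"

lemma nonzero_block_iff_Min:
  assumes "finite B"
  shows "nonzero_block B \<longleftrightarrow> B \<noteq> {} \<and> both_copies_in (Min (fst ` B)) B \<and>
           (\<forall>i. i \<noteq> Min (fst ` B) \<longrightarrow> \<not> both_copies_in i B)" (is "_ \<longleftrightarrow> ?R")
proof
  assume "nonzero_block B"
  then obtain m where m: "both_copies_in m B" "\<forall>p\<in>B. m \<le> fst p"
      "\<forall>i. i \<noteq> m \<longrightarrow> \<not> both_copies_in i B"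
    unfolding nonzero_block_def by blast
  have "m \<in> fst ` B" using m(1) by (force simp: both_copies_in_def)
  then have "Min (fst ` B) = m" using m(2) assms by (intro Min_eqI) auto
  with m show ?R by (auto simp: both_copies_in_def)
next
  assume ?R
  with assms show "nonzero_block B"
    unfolding nonzero_block_def by (intro exI[of _ "Min (fst ` B)"]) auto
qed

lemma disjoint_family_on_addresses:
  assumes "length Z = \<gamma>"
  shows "disjoint_family_on (block_at Z) (addresses \<gamma> N) \<longleftrightarrow>
    disjoint_family_on (\<lambda>i. Z ! i) {..<\<gamma>} \<and> disjoint N \<and> (\<forall>A\<in>set Z. \<forall>B\<in>N. A \<inter> B = {})"
    (is "?L \<longleftrightarrow> ?R")
proof
  assume L: ?L
  have *: "block_at Z l \<inter> block_at Z l' = {}"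
    if "l \<in> addresses \<gamma> N" "l' \<in> addresses \<gamma> N" "l \<noteq> l'" for l l'
    using L that by (simp add: disjoint_family_on_def)
  have "Z ! i \<inter> Z ! k = {}" if "i < \<gamma>" "k < \<gamma>" "i \<noteq> k" for i k
    using *[of "Inl i" "Inl k"] that by (simp add: addresses_def)
  moreover have "B \<inter> C = {}" if "B \<in> N" "C \<in> N" "B \<noteq> C" for B C
    using *[of "Inr B" "Inr C"] that by (simp add: addresses_def)
  moreover have "Z ! i \<inter> B = {}" if "i < \<gamma>" "B \<in> N" for i B
    using *[of "Inl i" "Inr B"] that by (simp add: addresses_def)
  ultimately show ?R
    using assms by (simp add: disjoint_family_on_def disjoint_def all_set_conv_all_nth)
next
  assume ?R
  then have ZZ: "Z ! i \<inter> Z ! k = {}" if "i < \<gamma>" "k < \<gamma>" "i \<noteq> k" for i k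
    using that by (simp add: disjoint_family_on_def)
  from \<open>?R\<close> have NN: "B \<inter> C = {}" if "B \<in> N" "C \<in> N" "B \<noteq> C" for B C
    using that by (simp add: disjoint_def)
  from \<open>?R\<close> have ZN: "Z ! i \<inter> B = {}" "B \<inter> Z ! i = {}" if "i < \<gamma>" "B \<in> N" for i B
    using that assms by (simp_all add: all_set_conv_all_nth Int_commute)
  show ?L
    unfolding disjoint_family_on_def
  proof (intro ballI impI)
    fix l l' assume "l \<in> addresses \<gamma> N" "l' \<in> addresses \<gamma> N" "l \<noteq> l'"
    then show "block_at Z l \<inter> block_at Z l' = {}"
      by (cases l; cases l') (simp_all add: addresses_def image_iff ZZ NN ZN)
  qed
qed

lemma Union_block_at:
  assumes "length Z = \<gamma>"
  shows "(\<Union>l\<in>addresses \<gamma> N. block_at Z l) = \<Union>(set Z) \<union> \<Union>N"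
  using assms unfolding addresses_def set_conv_nth by auto

text \<open>
  With addresses, the three disjointness conditions become a single one. Nonemptiness of the
  nonzero blocks is implicit in \<^const>\<open>nonzero_block\<close>.
\<close>

lemma JS_set_partitions_iff:
  "(Z, N) \<in> JS_set_partitions n j \<gamma> \<longleftrightarrow>
     length Z = \<gamma> \<and> card N = j \<and>
     disjoint_family_on (block_at Z) (addresses \<gamma> N) \<and>
     (\<Union>l\<in>addresses \<gamma> N. block_at Z l) = two_copies n \<and>
     (\<forall>i k k'. k < \<gamma> \<longrightarrow> k' < \<gamma> \<longrightarrow> (i, 1) \<in> Z ! k \<longrightarrow> (i, 2) \<notin> Z ! k') \<and>
     (\<forall>B\<in>N. nonzero_block B)"
proof -
  have zero: "(\<forall>i. \<not> both_copies_in i (\<Union>(set Z))) \<longleftrightarrow>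
      (\<forall>i k k'. k < \<gamma> \<longrightarrow> k' < \<gamma> \<longrightarrow> (i, 1) \<in> Z ! k \<longrightarrow> (i, 2) \<notin> Z ! k')" if "length Z = \<gamma>"
    using that by (fastforce simp: both_copies_in_def set_conv_nth)
  have nonzero: "(\<forall>B\<in>N. nonzero_block B) \<longleftrightarrow> {} \<notin> N \<and>
     (\<forall>B\<in>N. both_copies_in (Min (fst ` B)) B \<and>
        (\<forall>i. i \<noteq> Min (fst ` B) \<longrightarrow> \<not> both_copies_in i B))"
    if "\<Union>(set Z) \<union> \<Union>N = two_copies n"
  proof -
    have "finite B" if "B \<in> N" for B
      by (rule finite_subset[of _ "two_copies n"])
        (use that \<open>_ = two_copies n\<close> in \<open>auto simp: two_copies_def\<close>)
    then show ?thesis using nonzero_block_iff_Min by blast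
  qed
  show ?thesis
  proof (cases "length Z = \<gamma> \<and> \<Union>(set Z) \<union> \<Union>N = two_copies n")
    case True
    then have len: "length Z = \<gamma>" and un: "\<Union>(set Z) \<union> \<Union>N = two_copies n" by simp_all
    show ?thesis
      unfolding JS_set_partitions_def mem_Collect_eq case_prod_conv
        disjoint_family_on_addresses[OF len] Union_block_at[OF len]
        zero[OF len, symmetric] nonzero[OF un] by (simp only: conj_ac)
  next
    case False
    then have "length Z \<noteq> \<gamma> \<or> (\<Union>l\<in>addresses \<gamma> N. block_at Z l) \<noteq> two_copies n"
      using Union_block_at[of Z \<gamma> N] by metis
    moreover have "(Z, N) \<notin> JS_set_partitions n j \<gamma>"
      using False unfolding JS_set_partitions_def mem_Collect_eq case_prod_conv by blast
    ultimately show ?thesis by meson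
  qed
qed

lemma finite_nonzero_blocks:
  assumes "(Z, N) \<in> JS_set_partitions n j \<gamma>"
  shows "finite N"
proof (rule finite_subset)
  show "N \<subseteq> Pow (two_copies n)" using assms unfolding JS_set_partitions_def by auto
qed (simp add: two_copies_def)

section \<open>The two copies of the largest number in a common block\<close>

definition top_block :: "nat \<Rightarrow> (nat \<times> nat) set" where
  "top_block n = {(Suc n, 1), (Suc n, 2)}"

lemma two_copies_Suc: "two_copies (Suc n) = two_copies n \<union> top_block n"
  unfolding two_copies_def top_block_def by (auto simp: le_Suc_eq)

lemma two_copies_Int_top_block: "two_copies n \<inter> top_block n = {}"
  unfolding two_copies_def top_block_def by auto

lemma top_block_nonzero: "nonzero_block (top_block n)"
  unfolding nonzero_block_def top_block_def both_copies_in_def by auto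

text \<open>The bijection behind the equality inserts \<open>top_block n\<close> as a further nonzero block.\<close>

lemma card_with_top_block:
  "card {(Z, N). (Z, N) \<in> JS_set_partitions (Suc n) (Suc j) \<gamma> \<and> top_block n \<in> N}
     = card (JS_set_partitions n j \<gamma>)" (is "card ?T = _")
proof -
  let ?f = "\<lambda>(Z, N). (Z, insert (top_block n) N)"
  have new: "top_block n \<notin> N" if "(Z, N) \<in> JS_set_partitions n j \<gamma>" for Z N
    using that two_copies_Int_top_block[of n]
    unfolding JS_set_partitions_def top_block_def by auto
  have inj: "inj_on ?f (JS_set_partitions n j \<gamma>)"
    by (intro inj_onI) (use new in \<open>auto dest: insert_ident[THEN iffD1, rotated 2]\<close>)
  have "?f ` JS_set_partitions n j \<gamma> = ?T"
  proof (intro equalityI subsetI)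
    fix p assume "p \<in> ?f ` JS_set_partitions n j \<gamma>"
    then obtain Z N where p: "p = (Z, insert (top_block n) N)"
      and ZN: "(Z, N) \<in> JS_set_partitions n j \<gamma>" by auto
    have disj: "A \<inter> top_block n = {}" if "A \<in> set Z \<union> N" for A
      using ZN that two_copies_Int_top_block[of n] unfolding JS_set_partitions_def by blast
    have len: "length Z = \<gamma>" using ZN by (simp add: JS_set_partitions_iff)
    have "disjoint_family_on (block_at Z) (addresses \<gamma> (insert (top_block n) N))"
      using ZN disj disjoint_family_on_addresses[OF len]
      unfolding JS_set_partitions_iff by (auto simp: disjoint_def)
    moreover have "(\<Union>l\<in>addresses \<gamma> (insert (top_block n) N). block_at Z l) = two_copies (Suc n)"
      using ZN unfolding JS_set_partitions_iff Union_block_at[OF len] two_copies_Suc by auto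
    ultimately show "p \<in> ?T"
      using ZN new[OF ZN] finite_nonzero_blocks[OF ZN] top_block_nonzero p
      by (simp add: JS_set_partitions_iff)
  next
    fix p assume "p \<in> ?T"
    then obtain Z N where p: "p = (Z, N)" and top: "top_block n \<in> N"
      and ZN: "(Z, N) \<in> JS_set_partitions (Suc n) (Suc j) \<gamma>" by auto
    let ?N = "N - {top_block n}"
    have len: "length Z = \<gamma>" using ZN by (simp add: JS_set_partitions_iff)
    have dis: "disjoint N" "\<forall>A\<in>set Z. \<forall>B\<in>N. A \<inter> B = {}"
        "disjoint_family_on (\<lambda>i. Z ! i) {..<\<gamma>}"
      using ZN unfolding JS_set_partitions_def by auto
    have "A \<inter> top_block n = {}" if "A \<in> set Z \<union> ?N" for A
    proof (cases "A \<in> set Z")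
      case True
      then show ?thesis using dis(2) top by blast
    next
      case False
      then show ?thesis using dis(1) top that disjointD[of N A "top_block n"] by blast
    qed
    then have "\<Union>(set Z) \<union> \<Union>?N = (\<Union>(set Z) \<union> \<Union>N) - top_block n"
      using top by blast
    also have "\<dots> = two_copies n"
      using ZN two_copies_Int_top_block[of n] two_copies_Suc[of n]
      unfolding JS_set_partitions_def by auto
    finally have "(\<Union>l\<in>addresses \<gamma> ?N. block_at Z l) = two_copies n"
      unfolding Union_block_at[OF len] .
    moreover have "disjoint_family_on (block_at Z) (addresses \<gamma> ?N)"
      using dis unfolding disjoint_family_on_addresses[OF len] by (auto simp: disjoint_def)
    ultimately have "(Z, ?N) \<in> JS_set_partitions n j \<gamma>"
      using ZN top finite_nonzero_blocks[OF ZN] by (simp add: JS_set_partitions_iff)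
    moreover have "p = ?f (Z, ?N)" using p top by auto
    ultimately show "p \<in> ?f ` JS_set_partitions n j \<gamma>" by blast
  qed
  with card_image[OF inj] show ?thesis by simp
qed

section \<open>The two copies of the largest number in different blocks\<close>

definition placements ::
    "nat \<Rightarrow> (nat \<times> nat) set set \<Rightarrow>
      ((nat + (nat \<times> nat) set) \<times> (nat + (nat \<times> nat) set)) set" where
  "placements \<gamma> N = {(a, b). a \<in> addresses \<gamma> N \<and> b \<in> addresses \<gamma> N \<and> a \<noteq> b \<and>
     \<not> (isl a \<and> isl b)}"

lemma finite_placements:
  assumes "finite N"
  shows "finite (placements \<gamma> N)"
proof (rule finite_subset)
  show "placements \<gamma> N \<subseteq> addresses \<gamma> N \<times> addresses \<gamma> N" by (auto simp: placements_def)
qed (simp add: addresses_def assms)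

text \<open>
  The placements split according to whether the first copy goes to a nonzero block; then the
  second one may go to any other block, and otherwise it must go to a nonzero block.
\<close>

lemma card_placements:
  assumes "finite N" and "card N = Suc j"
  shows "card (placements \<gamma> N) = Suc j * (j + 2 * \<gamma>)"
proof -
  let ?I = "Inr ` N :: (nat + (nat \<times> nat) set) set"
  let ?A = "SIGMA a : ?I. addresses \<gamma> N - {a}"
  let ?B = "(Inl ` {..<\<gamma>} :: (nat + (nat \<times> nat) set) set) \<times> ?I"
  have fin: "finite (addresses \<gamma> N)" using assms by (simp add: addresses_def)
  have "card (addresses \<gamma> N) = \<gamma> + Suc j"
    unfolding addresses_def using assms
    by (subst card_Un_disjoint) (auto simp: card_image)
  then have "card (addresses \<gamma> N - {a}) = \<gamma> + j" if "a \<in> Inr ` N" for a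
    using that fin by (simp add: addresses_def)
  then have A: "card ?A = Suc j * (\<gamma> + j)"
    using assms fin by (simp add: card_SigmaI card_image)
  have B: "card ?B = \<gamma> * Suc j"
    using assms by (simp add: card_cartesian_product card_image)
  have "placements \<gamma> N = ?A \<union> ?B"
    unfolding placements_def addresses_def by auto
  also have "card \<dots> = card ?A + card ?B"
    using assms fin by (subst card_Un_disjoint) auto
  finally show ?thesis unfolding A B by (simp add: algebra_simps)
qed

definition arrivals :: "nat \<Rightarrow> 'l \<times> 'l \<Rightarrow> 'l \<Rightarrow> (nat \<times> nat) set" where
  "arrivals n ab l =
     (if l = fst ab then {(Suc n, 1)} else {}) \<union> (if l = snd ab then {(Suc n, 2)} else {})"

lemma mem_arrivals:
  "p \<in> arrivals n (a, b) l \<longleftrightarrow> p = (Suc n, 1) \<and> a = l \<or> p = (Suc n, 2) \<and> b = l"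
  unfolding arrivals_def by auto

text \<open>
  The pair names the addresses, in the partition before the extension, of the blocks that
  receive the first and the second copy of \<open>n + 1\<close>. Adding to each block whatever arrives there
  treats all blocks alike, so that no case distinction on the kinds of the two receiving blocks
  is needed.
\<close>

definition extend ::
    "nat \<Rightarrow> ((nat \<times> nat) set list \<times> (nat \<times> nat) set set) \<times>
      ((nat + (nat \<times> nat) set) \<times> (nat + (nat \<times> nat) set)) \<Rightarrow>
      (nat \<times> nat) set list \<times> (nat \<times> nat) set set" where
  "extend n = (\<lambda>((Z, N), ab).
     (map (\<lambda>i. Z ! i \<union> arrivals n ab (Inl i)) [0..<length Z],
      (\<lambda>B. B \<union> arrivals n ab (Inr B)) ` N))"

definition restrict ::
    "nat \<Rightarrow> (nat \<times> nat) set list \<times> (nat \<times> nat) set set \<Rightarrow>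
      (nat \<times> nat) set list \<times> (nat \<times> nat) set set" where
  "restrict n = (\<lambda>(Z, N). (map (\<lambda>A. A - top_block n) Z, (\<lambda>B. B - top_block n) ` N))"

lemma arrivals_subset: "arrivals n ab l \<subseteq> top_block n"
  unfolding arrivals_def top_block_def by auto

lemma block_at_Int_top_block:
  assumes "(Z, N) \<in> JS_set_partitions n j \<gamma>" and "l \<in> addresses \<gamma> N"
  shows "block_at Z l \<inter> top_block n = {}"
  using assms two_copies_Int_top_block[of n] unfolding JS_set_partitions_iff by blast

text \<open>
  The minimum stays the same, as \<open>n + 1\<close> exceeds it, and the block does not acquire both copies
  of \<open>n + 1\<close> because these go to different addresses.
\<close>

lemma nonzero_block_Un_arrivals:
  assumes "nonzero_block B" and "B \<subseteq> two_copies n" and "a \<noteq> b"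
  shows "nonzero_block (B \<union> arrivals n (a, b) l)"
proof -
  obtain m where m: "both_copies_in m B" "\<forall>p\<in>B. m \<le> fst p"
      "\<forall>i. i \<noteq> m \<longrightarrow> \<not> both_copies_in i B"
    using assms(1) unfolding nonzero_block_def by blast
  have "m \<le> n" using m(1) assms(2) by (auto simp: both_copies_in_def two_copies_def)
  moreover have "(Suc n, c) \<notin> B" for c using assms(2) by (auto simp: two_copies_def)
  ultimately show ?thesis
    unfolding nonzero_block_def using m assms(3)
    by (intro exI[of _ m]) (auto simp: both_copies_in_def mem_arrivals)
qed

text \<open>
  The block contains both copies of its minimum, and this minimum can be \<open>n + 1\<close> only in the top
  block; so the copies of the minimum survive the removal.
\<close>

lemma nonzero_block_Diff_top_block:
  assumes "nonzero_block B" and "B \<subseteq> two_copies (Suc n)" and "B \<noteq> top_block n"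
  shows "nonzero_block (B - top_block n)"
proof -
  obtain m where m: "both_copies_in m B" "\<forall>p\<in>B. m \<le> fst p"
      "\<forall>i. i \<noteq> m \<longrightarrow> \<not> both_copies_in i B"
    using assms(1) unfolding nonzero_block_def by blast
  have "m \<noteq> Suc n"
  proof
    assume "m = Suc n"
    then have "B = top_block n"
      using m(1,2) assms(2) by (fastforce simp: both_copies_in_def two_copies_def top_block_def)
    with assms(3) show False by simp
  qed
  then show ?thesis
    unfolding nonzero_block_def using m
    by (intro exI[of _ m]) (auto simp: both_copies_in_def top_block_def)
qed

text \<open>
  The elements of \<open>top_block n\<close> are new, so distinct blocks receive disjoint sets of new elements,
  and deleting these gives back the old blocks. In particular the nonzero blocks remain
  different from each other, which preserves their number, and none of them becomes the top
  block, since each keeps an old element.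
\<close>

lemma extend_props:
  assumes ZN: "(Z, N) \<in> JS_set_partitions n j \<gamma>" and ab: "(a, b) \<in> placements \<gamma> N"
  shows restrict_extend: "restrict n (extend n ((Z, N), (a, b))) = (Z, N)"
    and extend_mem: "extend n ((Z, N), (a, b)) \<in> JS_set_partitions (Suc n) j \<gamma>"
    and extend_top: "top_block n \<notin> snd (extend n ((Z, N), (a, b)))"
proof -
  have len: "length Z = \<gamma>" using ZN by (simp add: JS_set_partitions_iff)
  let ?g = "\<lambda>l. block_at Z l \<union> arrivals n (a, b) l"
  have diff: "?g l - top_block n = block_at Z l" if "l \<in> addresses \<gamma> N" for l
    using block_at_Int_top_block[OF ZN that] arrivals_subset[of n "(a, b)" l] by blast
  have diffZ: "Z ! i \<union> arrivals n (a, b) (Inl i) - top_block n = Z ! i" if "i < \<gamma>" for i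
    using diff[of "Inl i"] that by (simp add: addresses_def)
  have diffN: "B \<union> arrivals n (a, b) (Inr B) - top_block n = B" if "B \<in> N" for B
    using diff[of "Inr B"] that by (simp add: addresses_def)
  show "restrict n (extend n ((Z, N), (a, b))) = (Z, N)"
    unfolding restrict_def extend_def using len diffZ diffN
    by (auto simp: image_image intro!: nth_equalityI)
  let ?Z = "map (\<lambda>i. Z ! i \<union> arrivals n (a, b) (Inl i)) [0..<\<gamma>]"
  let ?h = "\<lambda>B. B \<union> arrivals n (a, b) (Inr B)"
  have ext: "extend n ((Z, N), (a, b)) = (?Z, ?h ` N)"
    unfolding extend_def using len by simp
  have inj: "inj_on ?h N" by (rule inj_on_inverseI[of _ "\<lambda>B. B - top_block n"]) (rule diffN)
  have a: "a \<in> addresses \<gamma> N" and b: "b \<in> addresses \<gamma> N" and "a \<noteq> b" and "\<not> (isl a \<and> isl b)"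
    using ab by (auto simp: placements_def)
  have addr: "addresses \<gamma> (?h ` N) = map_sum id ?h ` addresses \<gamma> N"
    unfolding addresses_def by (simp add: image_Un image_image)
  have blk: "block_at ?Z (map_sum id ?h l) = ?g l" if "l \<in> addresses \<gamma> N" for l
    using that by (auto simp: addresses_def)
  have dis: "disjoint_family_on (block_at Z) (addresses \<gamma> N)"
    using ZN by (simp add: JS_set_partitions_iff)
  have disg: "?g l \<inter> ?g l' = {}" if "l \<in> addresses \<gamma> N" "l' \<in> addresses \<gamma> N" "l \<noteq> l'" for l l'
  proof -
    have "block_at Z l \<inter> block_at Z l' = {}"
      using dis that by (simp add: disjoint_family_on_def)
    moreover have "arrivals n (a, b) l \<inter> arrivals n (a, b) l' = {}"
      using that by (auto simp: mem_arrivals)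
    ultimately show ?thesis
      using arrivals_subset[of n "(a, b)"] block_at_Int_top_block[OF ZN] that by blast
  qed
  have "disjoint_family_on (block_at ?Z) (addresses \<gamma> (?h ` N))"
    unfolding addr disjoint_family_on_def
  proof (intro ballI impI)
    fix l l' assume l: "l \<in> map_sum id ?h ` addresses \<gamma> N" "l' \<in> map_sum id ?h ` addresses \<gamma> N"
      and "l \<noteq> l'"
    from l obtain k k' where k: "k \<in> addresses \<gamma> N" "l = map_sum id ?h k"
      and k': "k' \<in> addresses \<gamma> N" "l' = map_sum id ?h k'" by blast
    have "k \<noteq> k'" using k(2) k'(2) \<open>l \<noteq> l'\<close> by blast
    then show "block_at ?Z l \<inter> block_at ?Z l' = {}"
      unfolding k(2) k'(2) blk[OF k(1)] blk[OF k'(1)] by (rule disg[OF k(1) k'(1)])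
  qed
  moreover have "(\<Union>l\<in>addresses \<gamma> (?h ` N). block_at ?Z l) = two_copies (Suc n)"
  proof -
    have "(\<Union>l\<in>addresses \<gamma> (?h ` N). block_at ?Z l) = (\<Union>l\<in>addresses \<gamma> N. ?g l)"
      unfolding addr using blk by (simp add: image_image)
    also have "\<dots> = (\<Union>l\<in>addresses \<gamma> N. block_at Z l) \<union> top_block n"
      using a b by (auto simp: mem_arrivals top_block_def)
    finally show ?thesis using ZN by (simp add: JS_set_partitions_iff two_copies_Suc)
  qed
  moreover have "(i, 2) \<notin> ?Z ! k'" if "k < \<gamma>" "k' < \<gamma>" "(i, 1) \<in> ?Z ! k" for i k k'
  proof
    assume *: "(i, 2) \<in> ?Z ! k'"
    have old: "\<not> ((i, 1) \<in> Z ! k \<and> (i, 2) \<in> Z ! k')"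
      using ZN that by (auto simp: JS_set_partitions_iff)
    have "(Suc n, c) \<notin> Z ! k" "(Suc n, c) \<notin> Z ! k'" if "c \<in> {1, 2}" for c
      using block_at_Int_top_block[OF ZN, of "Inl k"] block_at_Int_top_block[OF ZN, of "Inl k'"]
        \<open>k < \<gamma>\<close> \<open>k' < \<gamma>\<close> that by (auto simp: addresses_def top_block_def)
    then have "a = Inl k" "b = Inl k'"
      using * old that by (auto simp: mem_arrivals)
    with \<open>\<not> (isl a \<and> isl b)\<close> show False by simp
  qed
  moreover have "nonzero_block (?h B)" if "B \<in> N" for B
  proof (rule nonzero_block_Un_arrivals)
    show "nonzero_block B" using ZN that by (simp add: JS_set_partitions_iff)
    show "B \<subseteq> two_copies n" using ZN that by (auto simp: JS_set_partitions_def)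
  qed fact
  ultimately show "extend n ((Z, N), (a, b)) \<in> JS_set_partitions (Suc n) j \<gamma>"
    using ZN unfolding ext JS_set_partitions_iff by (simp add: card_image[OF inj])
  have "B \<noteq> {}" if "B \<in> N" for B using ZN that by (auto simp: JS_set_partitions_def)
  then show "top_block n \<notin> snd (extend n ((Z, N), (a, b)))"
    unfolding ext using diffN by fastforce
qed

text \<open>
  Restriction recovers the partition, and the block that received a copy is recognised by
  containing it.
\<close>

lemma inj_on_extend:
  "inj_on (extend n) (SIGMA (Z, N) : JS_set_partitions n j \<gamma>. placements \<gamma> N)"
    (is "inj_on _ ?S")
proof (rule inj_onI)
  fix p q assume p: "p \<in> ?S" and q: "q \<in> ?S" and eq: "extend n p = extend n q"
  obtain Z N a b where p': "p = ((Z, N), (a, b))" by (metis surj_pair)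
  obtain Z' N' c d where q': "q = ((Z', N'), (c, d))" by (metis surj_pair)
  have ZN: "(Z, N) \<in> JS_set_partitions n j \<gamma>" and ab: "(a, b) \<in> placements \<gamma> N"
    using p p' by auto
  have ZN': "(Z', N') \<in> JS_set_partitions n j \<gamma>" and cd': "(c, d) \<in> placements \<gamma> N'"
    using q q' by auto
  have same: "Z' = Z" "N' = N"
    using restrict_extend[OF ZN ab] restrict_extend[OF ZN' cd'] eq p' q' by auto
  have cd: "(c, d) \<in> placements \<gamma> N" using cd' same by simp
  have len: "length Z = \<gamma>" using ZN by (simp add: JS_set_partitions_iff)
  have arr: "arrivals n (a, b) l = arrivals n (c, d) l" if l: "l \<in> addresses \<gamma> N" for l
  proof -
    have "block_at Z l \<union> arrivals n (a, b) l = block_at Z l \<union> arrivals n (c, d) l"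
    proof (cases l)
      case (Inl i)
      then have "i < \<gamma>" using l by (auto simp: addresses_def)
      then show ?thesis using eq Inl len unfolding p' q' same extend_def by auto
    next
      case (Inr B)
      then have B: "B \<in> N" using l by (auto simp: addresses_def)
      have cut: "C \<union> arrivals n xy (Inr C) - top_block n = C" if "C \<in> N" for C xy
        using block_at_Int_top_block[OF ZN, of "Inr C"] arrivals_subset[of n xy "Inr C"] that
        by (auto simp: addresses_def)
      have images: "(\<lambda>C. C \<union> arrivals n (a, b) (Inr C)) ` N
          = (\<lambda>C. C \<union> arrivals n (c, d) (Inr C)) ` N"
        using eq by (simp add: p' q' same extend_def)
      from B have "B \<union> arrivals n (a, b) (Inr B) \<in> (\<lambda>C. C \<union> arrivals n (a, b) (Inr C)) ` N"
        by (rule imageI)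
      then obtain C where C: "C \<in> N"
        "B \<union> arrivals n (a, b) (Inr B) = C \<union> arrivals n (c, d) (Inr C)"
        unfolding images by (rule imageE)
      then have "B = C" using cut B by metis
      with C Inr show ?thesis by simp
    qed
    then show ?thesis
      using block_at_Int_top_block[OF ZN l] arrivals_subset[of n _ l] by blast
  qed
  have "a \<in> addresses \<gamma> N" "b \<in> addresses \<gamma> N" using ab by (auto simp: placements_def)
  moreover have "(Suc n, 1) \<in> arrivals n (a, b) a" "(Suc n, 2) \<in> arrivals n (a, b) b"
    by (simp_all add: mem_arrivals)
  ultimately have "(Suc n, 1) \<in> arrivals n (c, d) a" "(Suc n, 2) \<in> arrivals n (c, d) b"
    using arr by simp_all
  then have "a = c" "b = d" by (simp_all add: mem_arrivals)
  then show "p = q" using p' q' same by simp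
qed

text \<open>
  Since no nonzero block is the top block, every nonzero block keeps an element
  when the copies of \<open>n + 1\<close> are removed, so that different blocks remain different.
\<close>

lemma extend_surj:
  assumes ZN: "(Z, N) \<in> JS_set_partitions (Suc n) j \<gamma>" and top: "top_block n \<notin> N"
  shows "(Z, N) \<in> extend n ` (SIGMA (Z, N) : JS_set_partitions n j \<gamma>. placements \<gamma> N)"
proof -
  let ?cut = "\<lambda>B. B - top_block n"
  let ?r = "map_sum id ?cut"
  let ?Z = "map ?cut Z" and ?N = "?cut ` N"
  have len: "length Z = \<gamma>" using ZN by (simp add: JS_set_partitions_iff)
  have dis: "disjoint_family_on (block_at Z) (addresses \<gamma> N)"
    and un: "(\<Union>l\<in>addresses \<gamma> N. block_at Z l) = two_copies (Suc n)"
    using ZN by (simp_all add: JS_set_partitions_iff)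
  have nz: "nonzero_block (?cut B)" if "B \<in> N" for B
  proof (rule nonzero_block_Diff_top_block)
    show "nonzero_block B" using ZN that by (simp add: JS_set_partitions_iff)
    show "B \<subseteq> two_copies (Suc n)" using ZN that by (auto simp: JS_set_partitions_def)
    show "B \<noteq> top_block n" using that top by auto
  qed
  then have ne: "?cut B \<noteq> {}" if "B \<in> N" for B
    using that by (auto simp: nonzero_block_def both_copies_in_def)
  have inj: "inj_on ?cut N"
  proof (rule inj_onI)
    fix B C assume *: "B \<in> N" "C \<in> N" "?cut B = ?cut C"
    then have "B \<inter> C \<noteq> {}" using ne[of B] by blast
    then show "B = C" using ZN * unfolding JS_set_partitions_def by (auto dest: disjointD)
  qed
  have injr: "inj_on ?r (addresses \<gamma> N)"
  proof (rule inj_onI)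
    fix l l' assume "l \<in> addresses \<gamma> N" "l' \<in> addresses \<gamma> N" "?r l = ?r l'"
    then show "l = l'"
      using inj_onD[OF inj] by (cases l; cases l') (simp_all add: addresses_def image_iff)
  qed
  have addr: "addresses \<gamma> ?N = ?r ` addresses \<gamma> N"
    unfolding addresses_def by (simp add: image_Un image_image)
  have blk: "block_at ?Z (?r l) = ?cut (block_at Z l)" if "l \<in> addresses \<gamma> N" for l
    using that len by (auto simp: addresses_def)
  have "(Suc n, 1) \<in> two_copies (Suc n)" "(Suc n, 2) \<in> two_copies (Suc n)"
    by (auto simp: two_copies_def)
  then obtain a b where a: "a \<in> addresses \<gamma> N" "(Suc n, 1) \<in> block_at Z a"
    and b: "b \<in> addresses \<gamma> N" "(Suc n, 2) \<in> block_at Z b"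
    unfolding un[symmetric] by blast
  have uniq: "l = l'" if "l \<in> addresses \<gamma> N" "l' \<in> addresses \<gamma> N"
      "p \<in> block_at Z l" "p \<in> block_at Z l'" for l l' p
    using dis that unfolding disjoint_family_on_def by blast
  have zero: "(i, 2) \<notin> Z ! k'" if "k < \<gamma>" "k' < \<gamma>" "(i, 1) \<in> Z ! k" for i k k'
    using ZN that by (auto simp: JS_set_partitions_iff)
  have notl: "\<not> (isl a \<and> isl b)"
    using a b zero by (auto simp: addresses_def)
  \<comment> \<open>A block containing both copies of \<open>n + 1\<close> would be nonzero with minimum \<open>n + 1\<close>, hence the
      excluded top block.\<close>
  have "a \<noteq> b"
  proof
    assume "a = b"
    with notl a b obtain B where B: "a = Inr B" "B \<in> N" by (auto simp: addresses_def)
    have both: "both_copies_in (Suc n) B"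
      using a(2) b(2) unfolding both_copies_in_def \<open>a = b\<close>[symmetric] B(1) by simp
    have "nonzero_block B" using ZN B by (simp add: JS_set_partitions_iff)
    then obtain m where m: "both_copies_in m B" "\<forall>p\<in>B. m \<le> fst p"
      "\<forall>i. i \<noteq> m \<longrightarrow> \<not> both_copies_in i B"
      unfolding nonzero_block_def by blast
    have "m = Suc n" using m(3) both by auto
    moreover have "B \<subseteq> two_copies (Suc n)" using ZN B by (auto simp: JS_set_partitions_def)
    ultimately have "B \<subseteq> top_block n"
      using m(2) by (fastforce simp: two_copies_def top_block_def)
    with ne[OF B(2)] show False by blast
  qed
  then have "?r a \<noteq> ?r b" using injr a b by (auto dest: inj_onD)
  moreover have "\<not> (isl (?r a) \<and> isl (?r b))" using notl by (simp add: isl_map_sum)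
  ultimately have pl: "(?r a, ?r b) \<in> placements \<gamma> ?N"
    using a b by (auto simp: placements_def addr)
  have "disjoint_family_on (block_at ?Z) (addresses \<gamma> ?N)"
    unfolding addr disjoint_family_on_def
  proof (intro ballI impI)
    fix l l' assume l: "l \<in> ?r ` addresses \<gamma> N" "l' \<in> ?r ` addresses \<gamma> N" and "l \<noteq> l'"
    from l obtain k k' where k: "k \<in> addresses \<gamma> N" "l = ?r k"
      and k': "k' \<in> addresses \<gamma> N" "l' = ?r k'" by blast
    have "k \<noteq> k'" using k(2) k'(2) \<open>l \<noteq> l'\<close> by blast
    then show "block_at ?Z l \<inter> block_at ?Z l' = {}"
      unfolding k(2) k'(2) blk[OF k(1)] blk[OF k'(1)] using uniq[OF k(1) k'(1)] by blast
  qed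
  moreover have "(\<Union>l\<in>addresses \<gamma> ?N. block_at ?Z l) = two_copies n"
  proof -
    have "(\<Union>l\<in>addresses \<gamma> ?N. block_at ?Z l) = (\<Union>l\<in>addresses \<gamma> N. ?cut (block_at Z l))"
      unfolding addr using blk by (simp add: image_image)
    also have "\<dots> = ?cut (two_copies (Suc n))" unfolding un[symmetric] by blast
    finally show ?thesis using two_copies_Int_top_block[of n] two_copies_Suc[of n] by blast
  qed
  moreover have "card ?N = j" using ZN by (simp add: card_image[OF inj] JS_set_partitions_iff)
  ultimately have mem: "(?Z, ?N) \<in> JS_set_partitions n j \<gamma>"
    unfolding JS_set_partitions_iff using len nz zero by auto
  \<comment> \<open>The copies arrive exactly at the blocks from which they were removed, because \<open>?r\<close> does not
      identify the addresses of different blocks.\<close>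
  have refill: "?cut (block_at Z l) \<union> arrivals n (?r a, ?r b) (?r l) = block_at Z l"
    if l: "l \<in> addresses \<gamma> N" for l
  proof -
    have "?r a = ?r l \<longleftrightarrow> a = l" "?r b = ?r l \<longleftrightarrow> b = l"
      using injr a b l by (auto dest: inj_onD)
    moreover have "a = l \<longleftrightarrow> (Suc n, 1) \<in> block_at Z l" "b = l \<longleftrightarrow> (Suc n, 2) \<in> block_at Z l"
      using uniq a b l by blast+
    ultimately show ?thesis by (auto simp: mem_arrivals top_block_def)
  qed
  have refillZ: "?cut (Z ! i) \<union> arrivals n (?r a, ?r b) (Inl i) = Z ! i" if "i < \<gamma>" for i
    using refill[of "Inl i"] that by (simp add: addresses_def)
  have refillN: "?cut B \<union> arrivals n (?r a, ?r b) (Inr (?cut B)) = B" if "B \<in> N" for B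
    using refill[of "Inr B"] that by (simp add: addresses_def)
  have "extend n ((?Z, ?N), (?r a, ?r b)) = (Z, N)"
    unfolding extend_def using len refillZ refillN
    by (auto simp: image_image intro!: nth_equalityI)
  then show ?thesis using mem pl by (intro image_eqI[where x = "((?Z, ?N), (?r a, ?r b))"]) auto
qed

lemma bij_betw_extend:
  "bij_betw (extend n) (SIGMA (Z, N) : JS_set_partitions n j \<gamma>. placements \<gamma> N)
     {(Z, N). (Z, N) \<in> JS_set_partitions (Suc n) j \<gamma> \<and> top_block n \<notin> N}"
  unfolding bij_betw_def
proof (intro conjI equalityI subsetI inj_on_extend)
  fix p assume "p \<in> extend n ` (SIGMA (Z, N) : JS_set_partitions n j \<gamma>. placements \<gamma> N)"
  then show "p \<in> {(Z, N). (Z, N) \<in> JS_set_partitions (Suc n) j \<gamma> \<and> top_block n \<notin> N}"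
    using extend_mem extend_top by (fastforce simp: case_prod_unfold)
qed (use extend_surj in auto)

lemma card_without_top_block:
  "card {(Z, N). (Z, N) \<in> JS_set_partitions (Suc n) (Suc j) \<gamma> \<and> top_block n \<notin> N}
     = Suc j * (j + 2 * \<gamma>) * card (JS_set_partitions n (Suc j) \<gamma>)"
proof -
  have pl: "finite N" "card (placements \<gamma> N) = Suc j * (j + 2 * \<gamma>)"
    if "(Z, N) \<in> JS_set_partitions n (Suc j) \<gamma>" for Z N
    using that finite_nonzero_blocks[OF that] card_placements[of N j \<gamma>]
    by (simp_all add: JS_set_partitions_iff)
  have "card (SIGMA (Z, N) : JS_set_partitions n (Suc j) \<gamma>. placements \<gamma> N)
      = (\<Sum>(Z, N) \<in> JS_set_partitions n (Suc j) \<gamma>. card (placements \<gamma> N))"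
    using finite_JS_set_partitions finite_placements[OF pl(1)]
    by (subst card_SigmaI) (auto simp: case_prod_unfold)
  also have "\<dots> = (\<Sum>_ \<in> JS_set_partitions n (Suc j) \<gamma>. Suc j * (j + 2 * \<gamma>))"
    using pl(2) by (intro sum.cong) auto
  finally show ?thesis
    using bij_betw_same_card[OF bij_betw_extend[of n "Suc j" \<gamma>]] by simp
qed

section \<open>The recurrence\<close>

lemma card_JS_set_partitions_Suc_Suc:
  "card (JS_set_partitions (Suc n) (Suc j) \<gamma>) =
     card (JS_set_partitions n j \<gamma>)
     + Suc j * (j + 2 * \<gamma>) * card (JS_set_partitions n (Suc j) \<gamma>)"
proof -
  let ?J = "JS_set_partitions (Suc n) (Suc j) \<gamma>"
  let ?T = "{(Z, N). (Z, N) \<in> ?J \<and> top_block n \<in> N}"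
  let ?U = "{(Z, N). (Z, N) \<in> ?J \<and> top_block n \<notin> N}"
  have "?J = ?T \<union> ?U" by auto
  moreover have "finite ?T" "finite ?U"
    by (auto intro: finite_subset[OF _ finite_JS_set_partitions])
  ultimately have "card ?J = card ?T + card ?U"
    using card_Un_disjoint[of ?T ?U] by fastforce
  then show ?thesis unfolding card_with_top_block card_without_top_block .
qed

lemma JS_set_partitions_0_0: "JS_set_partitions 0 0 \<gamma> = {(replicate \<gamma> {}, {})}"
proof -
  have "p = (replicate \<gamma> {}, {})" if p: "p \<in> JS_set_partitions 0 0 \<gamma>" for p
  proof -
    obtain Z N where ZN: "p = (Z, N)" by (cases p)
    have "Z = replicate \<gamma> {}"
      using p ZN by (intro replicate_eqI) (auto simp: JS_set_partitions_def two_copies_def)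
    moreover have "N = {}"
      using p ZN finite_nonzero_blocks[of Z N] by (simp add: JS_set_partitions_iff)
    ultimately show ?thesis using ZN by simp
  qed
  moreover have "(replicate \<gamma> {}, {}) \<in> JS_set_partitions 0 0 \<gamma>"
    by (auto simp: JS_set_partitions_def two_copies_def disjoint_family_on_def both_copies_in_def)
  ultimately show ?thesis by blast
qed

lemma JS_set_partitions_0_Suc: "JS_set_partitions 0 (Suc j) \<gamma> = {}"
proof -
  have False if "(Z, N) \<in> JS_set_partitions 0 (Suc j) \<gamma>" for Z N
  proof -
    have "\<Union>N = {}" "{} \<notin> N" "card N = Suc j"
      using that by (auto simp: JS_set_partitions_def two_copies_def)
    then show False by (metis Union_empty_conv card.empty ex_in_conv nat.distinct(1))
  qed
  then show ?thesis by fast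
qed

text \<open>Without nonzero blocks both copies of \<open>1\<close> would lie in zero blocks.\<close>

lemma JS_set_partitions_Suc_0: "JS_set_partitions (Suc n) 0 \<gamma> = {}"
proof -
  have False if ZN: "(Z, N) \<in> JS_set_partitions (Suc n) 0 \<gamma>" for Z N
  proof -
    have "N = {}" using ZN finite_nonzero_blocks[OF ZN] by (simp add: JS_set_partitions_iff)
    then have "\<Union>(set Z) = two_copies (Suc n)" "\<not> both_copies_in 1 (\<Union>(set Z))"
      using ZN by (auto simp: JS_set_partitions_def)
    then show False by (auto simp: both_copies_in_def two_copies_def)
  qed
  then show ?thesis by fast
qed

theorem theorem4p1:
  fixes n j \<gamma> :: nat
  shows "poly (jacobi_stirling n j) (int \<gamma>) = int (card (JS_set_partitions n j \<gamma>))"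
proof (induction n j rule: jacobi_stirling.induct)
  case (4 n j)
  \<comment> \<open>Here \<open>Suc j\<close> is the number of nonzero blocks, so that \<open>Suc j + 2 \<gamma> - 1\<close> becomes \<open>j + 2 \<gamma>\<close>.\<close>
  have "poly (of_nat (Suc j) * (of_nat (Suc j) + 2 * [:0, 1:] - 1)) (int \<gamma>)
      = int (Suc j * (j + 2 * \<gamma>))"
    by (simp add: algebra_simps)
  with 4 show ?case
    unfolding jacobi_stirling.simps poly_add poly_mult[of "_ * _" "jacobi_stirling _ _"]
      card_JS_set_partitions_Suc_Suc by simp
qed (simp_all add: JS_set_partitions_0_0 JS_set_partitions_0_Suc JS_set_partitions_Suc_0)

end
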